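(* For a uniform space $(X,\mu)$ the following statements are equivalent: (1) $(X,\mu)$ is uniformly locally compact; (2) $(X,\mu)$ is locally Bourbaki-bounded in $X$ and cofinally Bourbaki-complete; (3) $(X,\mu)$ is locally totally bounded and cofinally complete; (4) $(X,s_f\mu)$ is uniformly locally compact; (5) $(X,s_f\mu)$ is locally Bourbaki-bounded in $X$ and cofinally Bourbaki-complete; (6) $(X,s_f\mu)$ is locally totally bounded and cofinally complete.
   Context: Uniform spaces are Hausdorff and given by covers: $\mu$ is a family of covers of $X$ (the uniform covers), containing every cover refined by a member of $\mu$, and such that any two members of $\mu$ have a common star-refinement in $\mu$. For a cover $\mathcal U$ of $X$ and $A\subset X$: $St(A,\mathcal U)=\bigcup\{U\in\mathcal U: U\cap A\neq\emptyset\}$, $St^0(A,\mathcal U)=A$, $St^m(A,\mathcal U)=St(St^{m-1}(A,\mathcal U),\mathcal U)$ for $m\geq 1$. A subset $B\subset X$ is a Bourbaki-bounded subset in $(X,\mu)$ if for every $\mathcal U\in\mu$ there are $m\in\mathbb N$ and finitely many $U_1,\dots,U_k\in\mathcal U$ with $B\subset\bigcup_{i=1}^k St^m(U_i,\mathcal U)$; it is totally bounded if for every $\mathcal U\in\mu$ there are finitely many $U_1,\dots,U_k\in\mathcal U$ with $B\subset\bigcup_{i=1}^k U_i$. Let $P$ be the property of being a compact, a totally bounded, or a Bourbaki-bounded (in $X$) subset of a uniform space $(X,\mu)$. $(X,\mu)$ is locally $P$ if every $x\in X$ has a neighborhood satisfying $P$, and uniformly locally $P$ if there is $\mathcal U\in\mu$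 such that every $U\in\mathcal U$ satisfies $P$. A filter $\mathcal F$ on $X$ is cofinally Cauchy if for every $\mathcal U\in\mu$ there is $U\in\mathcal U$ with $F\cap U\neq\emptyset$ for all $F\in\mathcal F$; it is cofinally Bourbaki-Cauchy if for every $\mathcal U\in\mu$ there are $m\in\mathbb N$ and $U\in\mathcal U$ with $F\cap St^m(U,\mathcal U)\neq\emptyset$ for all $F\in\mathcal F$. $(X,\mu)$ is cofinally complete (respectively cofinally Bourbaki-complete) if every cofinally Cauchy (respectively cofinally Bourbaki-Cauchy) filter has a cluster point. A cover is star-finite if each of its members meets at most finitely many of its members. $s_f\mu$ denotes the uniformity on $X$ (compatible with the topology of $X$) having as a base the family of all star-finite open covers belonging to $\mu$. *)

theory Defs
  imports "HOL-Analysis.Analysis"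
begin

definition cover_of :: "'a set \<Rightarrow> 'a set set \<Rightarrow> bool" where
  "cover_of X \<U> \<longleftrightarrow> \<U> \<subseteq> Pow X \<and> \<Union>\<U> = X"

definition refines :: "'a set set \<Rightarrow> 'a set set \<Rightarrow> bool" where
  "refines \<V> \<U> \<longleftrightarrow> (\<forall>V\<in>\<V>. \<exists>U\<in>\<U>. V \<subseteq> U)"

definition St :: "'a set \<Rightarrow> 'a set set \<Rightarrow> 'a set" where
  "St A \<U> = \<Union>{U \<in> \<U>. U \<inter> A \<noteq> {}}"

definition St_iter :: "nat \<Rightarrow> 'a set \<Rightarrow> 'a set set \<Rightarrow> 'a set" where
  "St_iter m A \<U> = ((\<lambda>B. St B \<U>) ^^ m) A"

definition star_refines :: "'a set set \<Rightarrow> 'a set set \<Rightarrow> bool" where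
  "star_refines \<V> \<U> \<longleftrightarrow> refines ((\<lambda>V. St V \<V>) ` \<V>) \<U>"

text \<open>The topology induced by a family of covers. The predicate is a topology as soon as the
  family is nonempty and closed under common refinements; see \<open>openin_uniform_topology\<close> below.\<close>

definition uniform_topology :: "'a set \<Rightarrow> 'a set set set \<Rightarrow> 'a topology" where
  "uniform_topology X \<mu> =
     topology (\<lambda>W. W \<subseteq> X \<and> (\<forall>x\<in>W. \<exists>\<U>\<in>\<mu>. St {x} \<U> \<subseteq> W))"

text \<open>A uniformity is nonempty by convention; without this the upward closure and star-refinement
  axioms would also admit the empty family, which induces no topology.\<close>

definition covering_uniformity :: "'a set \<Rightarrow> 'a set set set \<Rightarrow> bool" where
  "covering_uniformity X \<mu> \<longleftrightarrow>
     \<mu> \<noteq> {} \<and>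
     (\<forall>\<U>\<in>\<mu>. cover_of X \<U>) \<and>
     (\<forall>\<V>\<in>\<mu>. \<forall>\<U>. cover_of X \<U> \<and> refines \<V> \<U> \<longrightarrow> \<U> \<in> \<mu>) \<and>
     (\<forall>\<U>\<in>\<mu>. \<forall>\<V>\<in>\<mu>. \<exists>\<W>\<in>\<mu>. star_refines \<W> \<U> \<and> star_refines \<W> \<V>)"

definition Hausdorff_uniform_space :: "'a set \<Rightarrow> 'a set set set \<Rightarrow> bool" where
  "Hausdorff_uniform_space X \<mu> \<longleftrightarrow>
     covering_uniformity X \<mu> \<and> Hausdorff_space (uniform_topology X \<mu>)"

definition compact_subset :: "'a set \<Rightarrow> 'a set set set \<Rightarrow> 'a set \<Rightarrow> bool" where
  "compact_subset X \<mu> B \<longleftrightarrow> compactin (uniform_topology X \<mu>) B"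

definition totally_bounded_subset :: "'a set \<Rightarrow> 'a set set set \<Rightarrow> 'a set \<Rightarrow> bool" where
  "totally_bounded_subset X \<mu> B \<longleftrightarrow>
     B \<subseteq> X \<and> (\<forall>\<U>\<in>\<mu>. \<exists>\<F>\<subseteq>\<U>. finite \<F> \<and> B \<subseteq> \<Union>\<F>)"

definition Bourbaki_bounded_subset :: "'a set \<Rightarrow> 'a set set set \<Rightarrow> 'a set \<Rightarrow> bool" where
  "Bourbaki_bounded_subset X \<mu> B \<longleftrightarrow>
     B \<subseteq> X \<and> (\<forall>\<U>\<in>\<mu>. \<exists>m. \<exists>\<F>\<subseteq>\<U>. finite \<F> \<and> B \<subseteq> (\<Union>U\<in>\<F>. St_iter m U \<U>))"

definition locally_satisfies ::
  "('a set \<Rightarrow> 'a set set set \<Rightarrow> 'a set \<Rightarrow> bool) \<Rightarrow> 'a set \<Rightarrow> 'a set set set \<Rightarrow> bool" where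
  "locally_satisfies P X \<mu> \<longleftrightarrow>
     (\<forall>x\<in>X. \<exists>W N. openin (uniform_topology X \<mu>) W \<and> x \<in> W \<and> W \<subseteq> N \<and> N \<subseteq> X \<and> P X \<mu> N)"

definition uniformly_locally_satisfies ::
  "('a set \<Rightarrow> 'a set set set \<Rightarrow> 'a set \<Rightarrow> bool) \<Rightarrow> 'a set \<Rightarrow> 'a set set set \<Rightarrow> bool" where
  "uniformly_locally_satisfies P X \<mu> \<longleftrightarrow> (\<exists>\<U>\<in>\<mu>. \<forall>U\<in>\<U>. P X \<mu> U)"

text \<open>The library's filters live on a whole type and may be improper, so a filter on the
  carrier is a proper filter below \<open>principal X\<close>; its members are the sets \<open>A\<close> with
  \<open>eventually (\<lambda>x. x \<in> A) F\<close>. Intersecting a member with \<open>X\<close> gives again a member, so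
  members that are not contained in \<open>X\<close> do not affect the notions below.\<close>

definition filter_on :: "'a set \<Rightarrow> 'a filter \<Rightarrow> bool" where
  "filter_on X F \<longleftrightarrow> F \<noteq> bot \<and> F \<le> principal X"

definition cofinally_Cauchy :: "'a set set set \<Rightarrow> 'a filter \<Rightarrow> bool" where
  "cofinally_Cauchy \<mu> F \<longleftrightarrow>
     (\<forall>\<U>\<in>\<mu>. \<exists>U\<in>\<U>. \<forall>A. eventually (\<lambda>x. x \<in> A) F \<longrightarrow> A \<inter> U \<noteq> {})"

definition cofinally_Bourbaki_Cauchy :: "'a set set set \<Rightarrow> 'a filter \<Rightarrow> bool" where
  "cofinally_Bourbaki_Cauchy \<mu> F \<longleftrightarrow>
     (\<forall>\<U>\<in>\<mu>. \<exists>m. \<exists>U\<in>\<U>. \<forall>A. eventually (\<lambda>x. x \<in> A) F \<longrightarrow> A \<inter> St_iter m U \<U> \<noteq> {})"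

definition cluster_point :: "'a topology \<Rightarrow> 'a filter \<Rightarrow> 'a \<Rightarrow> bool" where
  "cluster_point T F x \<longleftrightarrow> (\<forall>A. eventually (\<lambda>y. y \<in> A) F \<longrightarrow> x \<in> T closure_of A)"

definition cofinally_complete :: "'a set \<Rightarrow> 'a set set set \<Rightarrow> bool" where
  "cofinally_complete X \<mu> \<longleftrightarrow>
     (\<forall>F. filter_on X F \<and> cofinally_Cauchy \<mu> F \<longrightarrow>
        (\<exists>x\<in>X. cluster_point (uniform_topology X \<mu>) F x))"

definition cofinally_Bourbaki_complete :: "'a set \<Rightarrow> 'a set set set \<Rightarrow> bool" where
  "cofinally_Bourbaki_complete X \<mu> \<longleftrightarrow>
     (\<forall>F. filter_on X F \<and> cofinally_Bourbaki_Cauchy \<mu> F \<longrightarrow>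
        (\<exists>x\<in>X. cluster_point (uniform_topology X \<mu>) F x))"

definition star_finite :: "'a set set \<Rightarrow> bool" where
  "star_finite \<U> \<longleftrightarrow> (\<forall>U\<in>\<U>. finite {V \<in> \<U>. U \<inter> V \<noteq> {}})"

definition star_finite_open_covers :: "'a set \<Rightarrow> 'a set set set \<Rightarrow> 'a set set set" where
  "star_finite_open_covers X \<mu> =
     {\<U> \<in> \<mu>. star_finite \<U> \<and> (\<forall>U\<in>\<U>. openin (uniform_topology X \<mu>) U)}"

definition sf_uniformity :: "'a set \<Rightarrow> 'a set set set \<Rightarrow> 'a set set set" where
  "sf_uniformity X \<mu> =
     {\<U>. cover_of X \<U> \<and> (\<exists>\<V>\<in>star_finite_open_covers X \<mu>. refines \<V> \<U>)}"

lemma St_mono_refines: "refines \<W> \<U> \<Longrightarrow> St A \<W> \<subseteq> St A \<U>"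
  unfolding refines_def St_def by blast

lemma refines_trans: "refines \<W> \<V> \<Longrightarrow> refines \<V> \<U> \<Longrightarrow> refines \<W> \<U>"
  unfolding refines_def by (meson subset_trans)

lemma star_refines_imp_refines: "star_refines \<W> \<U> \<Longrightarrow> refines \<W> \<U>"
  unfolding star_refines_def refines_def St_def
proof
  fix V assume h: "\<forall>V\<in>(\<lambda>V. \<Union>{U \<in> \<W>. U \<inter> V \<noteq> {}}) ` \<W>. \<exists>U\<in>\<U>. V \<subseteq> U" and V: "V \<in> \<W>"
  then obtain U where "U \<in> \<U>" "\<Union>{U \<in> \<W>. U \<inter> V \<noteq> {}} \<subseteq> U" by blast
  then show "\<exists>U\<in>\<U>. V \<subseteq> U" using V by blast
qed

lemma openin_uniform_topology_directed:
  assumes "\<mu> \<noteq> {}" and "\<And>\<U>. \<U> \<in> \<mu> \<Longrightarrow> cover_of X \<U>"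
    and dir: "\<And>\<U> \<V>. \<U> \<in> \<mu> \<Longrightarrow> \<V> \<in> \<mu> \<Longrightarrow> \<exists>\<W>\<in>\<mu>. refines \<W> \<U> \<and> refines \<W> \<V>"
  shows "openin (uniform_topology X \<mu>) W \<longleftrightarrow>
           W \<subseteq> X \<and> (\<forall>x\<in>W. \<exists>\<U>\<in>\<mu>. St {x} \<U> \<subseteq> W)"
    and "topspace (uniform_topology X \<mu>) = X"
proof -
  have "istopology (\<lambda>W. W \<subseteq> X \<and> (\<forall>x\<in>W. \<exists>\<U>\<in>\<mu>. St {x} \<U> \<subseteq> W))"
    unfolding istopology_def
  proof (intro conjI allI impI)
    fix S T
    assume S: "S \<subseteq> X \<and> (\<forall>x\<in>S. \<exists>\<U>\<in>\<mu>. St {x} \<U> \<subseteq> S)"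
      and T: "T \<subseteq> X \<and> (\<forall>x\<in>T. \<exists>\<U>\<in>\<mu>. St {x} \<U> \<subseteq> T)"
    show "S \<inter> T \<subseteq> X" using S by blast
    show "\<forall>x\<in>S \<inter> T. \<exists>\<U>\<in>\<mu>. St {x} \<U> \<subseteq> S \<inter> T"
    proof
      fix x assume "x \<in> S \<inter> T"
      then obtain \<U> \<V> where "\<U> \<in> \<mu>" "St {x} \<U> \<subseteq> S" "\<V> \<in> \<mu>" "St {x} \<V> \<subseteq> T"
        using S T by blast
      moreover then obtain \<W> where "\<W> \<in> \<mu>" "refines \<W> \<U>" "refines \<W> \<V>"
        using dir by blast
      ultimately show "\<exists>\<U>\<in>\<mu>. St {x} \<U> \<subseteq> S \<inter> T"
        by (meson St_mono_refines le_infI subset_trans)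
    qed
  next
    fix K
    assume K: "\<forall>S\<in>K. S \<subseteq> X \<and> (\<forall>x\<in>S. \<exists>\<U>\<in>\<mu>. St {x} \<U> \<subseteq> S)"
    show "\<Union>K \<subseteq> X" using K by blast
    show "\<forall>x\<in>\<Union>K. \<exists>\<U>\<in>\<mu>. St {x} \<U> \<subseteq> \<Union>K"
      using K by (meson UnionE Union_upper subset_trans)
  qed
  then show op: "openin (uniform_topology X \<mu>) W \<longleftrightarrow>
      W \<subseteq> X \<and> (\<forall>x\<in>W. \<exists>\<U>\<in>\<mu>. St {x} \<U> \<subseteq> W)" for W
    by (simp add: uniform_topology_def topology_inverse')
  have "openin (uniform_topology X \<mu>) X"
    using assms(1,2) unfolding op cover_of_def St_def by blast
  then show "topspace (uniform_topology X \<mu>) = X"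
    by (metis op openin_subset openin_topspace subset_antisym)
qed

lemma openin_uniform_topology:
  assumes "covering_uniformity X \<mu>"
  shows "openin (uniform_topology X \<mu>) W \<longleftrightarrow>
           W \<subseteq> X \<and> (\<forall>x\<in>W. \<exists>\<U>\<in>\<mu>. St {x} \<U> \<subseteq> W)"
    and "topspace (uniform_topology X \<mu>) = X"
proof -
  have "\<exists>\<W>\<in>\<mu>. refines \<W> \<U> \<and> refines \<W> \<V>" if "\<U> \<in> \<mu>" "\<V> \<in> \<mu>" for \<U> \<V>
    using assms that star_refines_imp_refines unfolding covering_uniformity_def by meson
  then show "openin (uniform_topology X \<mu>) W \<longleftrightarrow>
           W \<subseteq> X \<and> (\<forall>x\<in>W. \<exists>\<U>\<in>\<mu>. St {x} \<U> \<subseteq> W)"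
    and "topspace (uniform_topology X \<mu>) = X"
    using assms openin_uniform_topology_directed[of \<mu> X]
    unfolding covering_uniformity_def by blast+
qed

end

theory Submission
  imports Defs
begin

text \<open>Uniform local compactness is compared with the other conditions through two facts, each of
  which serves both \<open>\<mu>\<close> and its star-finite modification, since the two families induce the same
  topology.

  For the way from completeness to uniform local compactness: every filter on a totally bounded
  set is cofinally Cauchy, and every filter on a Bourbaki-bounded set is cofinally
  Bourbaki-Cauchy. Completeness therefore makes closed subsets of such sets compact, and by
  regularity the space is locally compact. If no uniform cover consisted of relatively compact
  sets, the complements of the compact sets would generate a cofinally Cauchy filter, because in
  each uniform cover some member is contained in no compact set; but by local compactness this
  filter has no cluster point (lemma \<open>uniformly_locally_compact_if_cofinally_complete\<close>).

  For the way back: a uniformly locally compact space has an open uniform cover \<open>\<V>\<close> whose members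
  have relatively compact stars, so all iterated stars of points are relatively compact. A base
  point is fixed in each chain component of \<open>\<V>\<close>. The stars of the layers of points at a given
  chain distance from the base point form a star-finite, open, uniform and relatively compact
  cover (lemmas \<open>star_finite_coarsening\<close> and \<open>star_finite_cover_with_relatively_compact_stars\<close>).
  By star-finiteness the stars of its members are relatively compact too, hence so are all their
  iterated stars. This cover belongs to \<open>\<mu>\<close> and to its star-finite modification. It makes the
  modification uniformly locally compact; and for either family, every cofinally Bourbaki-Cauchy
  filter has all its members meet one fixed compact set, so it has a cluster point.

  Star-refinements in the modification are never needed: it suffices that it is an upward closed
  family of covers inducing the original topology, and the latter follows from the uniformity of
  suitable two-element open covers (lemma \<open>finite_open_cover_at_point\<close>).\<close>

section \<open>Filters and compactness\<close>

lemma compactin_meets_imp_cluster_point: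
  assumes K: "compactin T K" and meet: "\<And>A. eventually (\<lambda>x. x \<in> A) F \<Longrightarrow> A \<inter> K \<noteq> {}"
  shows "\<exists>x\<in>K. cluster_point T F x"
proof (rule ccontr)
  assume "\<not> ?thesis"
  then obtain A where A: "\<And>x. x \<in> K \<Longrightarrow> eventually (\<lambda>y. y \<in> A x) F"
      "\<And>x. x \<in> K \<Longrightarrow> x \<notin> T closure_of A x"
    unfolding cluster_point_def by metis
  let ?O = "\<lambda>x. topspace T - T closure_of A x"
  have KT: "K \<subseteq> topspace T" using K by (rule compactin_subset_topspace)
  have "\<And>U. U \<in> ?O ` K \<Longrightarrow> openin T U" by auto
  moreover have "K \<subseteq> \<Union>(?O ` K)" using KT A(2) by auto
  ultimately obtain G where "finite G" "G \<subseteq> ?O ` K" "K \<subseteq> \<Union>G"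
    using compactinD[OF K, of "?O ` K"] by metis
  then obtain Y where Y: "finite Y" "Y \<subseteq> K" "K \<subseteq> \<Union>(?O ` Y)"
    by (metis finite_subset_image)
  have "eventually (\<lambda>y. \<forall>x\<in>Y. y \<in> A x) F"
    using Y A(1) by (simp add: eventually_ball_finite_distrib subset_eq)
  then have "(\<Inter>x\<in>Y. A x) \<inter> K \<noteq> {}"
    by (intro meet) simp
  then obtain y where y: "y \<in> K" "\<And>x. x \<in> Y \<Longrightarrow> y \<in> A x" by blast
  then obtain x where x: "x \<in> Y" "y \<notin> T closure_of A x" using Y(3) by blast
  then show False
    using y KT closure_of_subset_Int[of T "A x"] by blast
qed

lemma compactin_if_cluster_points:
  assumes C: "closedin T C"
    and cl: "\<And>F. F \<noteq> bot \<Longrightarrow> F \<le> principal C \<Longrightarrow> \<exists>x. cluster_point T F x"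
  shows "compactin T C"
  unfolding compactin_fip
proof (intro conjI allI impI)
  show "C \<subseteq> topspace T" using C by (rule closedin_subset)
next
  fix \<U> assume U: "(\<forall>D\<in>\<U>. closedin T D) \<and> (\<forall>\<F>. finite \<F> \<and> \<F> \<subseteq> \<U> \<longrightarrow> C \<inter> \<Inter>\<F> \<noteq> {})"
  define F where "F = (INF D\<in>insert C \<U>. principal D)"
  have "F \<noteq> bot"
    unfolding F_def
  proof (rule INF_filter_not_bot)
    fix Y assume Y: "Y \<subseteq> insert C \<U>" "finite Y"
    have "finite (Y - {C}) \<and> Y - {C} \<subseteq> \<U>" using Y by auto
    with U have "C \<inter> \<Inter>(Y - {C}) \<noteq> {}" by simp
    moreover have "C \<inter> \<Inter>(Y - {C}) \<subseteq> \<Inter>Y" by blast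
    ultimately show "(INF D\<in>Y. principal D) \<noteq> bot"
      using Y(2) by (auto simp: INF_principal_finite principal_eq_bot_iff)
  qed
  moreover have le: "F \<le> principal D" if "D \<in> insert C \<U>" for D
    unfolding F_def using that by (rule INF_lower)
  ultimately obtain x where "cluster_point T F x" using cl by blast
  then have "x \<in> T closure_of D" if "D \<in> insert C \<U>" for D
    using le[OF that] unfolding cluster_point_def le_principal by blast
  then have "x \<in> D" if "D \<in> insert C \<U>" for D
    using that U C by (metis closure_of_eq insert_iff)
  then show "C \<inter> \<Inter>\<U> \<noteq> {}" by blast
qed

text \<open>With \<open>f\<close> the identity or an iterated star, this makes the filters on totally bounded or
  Bourbaki-bounded sets cofinally Cauchy or cofinally Bourbaki-Cauchy.\<close>

lemma finite_cover_meets_filter: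
  assumes F: "F \<noteq> bot" "F \<le> principal B" and fin: "finite \<F>" and cov: "B \<subseteq> \<Union>(f ` \<F>)"
  shows "\<exists>U\<in>\<F>. \<forall>A. eventually (\<lambda>x. x \<in> A) F \<longrightarrow> A \<inter> f U \<noteq> {}"
proof (rule ccontr)
  assume "\<not> ?thesis"
  then obtain A where A: "\<And>U. U \<in> \<F> \<Longrightarrow> eventually (\<lambda>x. x \<in> A U) F"
      "\<And>U. U \<in> \<F> \<Longrightarrow> A U \<inter> f U = {}" by metis
  have "eventually (\<lambda>x. \<forall>U\<in>\<F>. x \<in> A U) F"
    using A(1) fin by (simp add: eventually_ball_finite_distrib)
  moreover have "eventually (\<lambda>x. x \<in> B) F" using F(2) by (simp add: le_principal)
  ultimately have "eventually (\<lambda>x. False) F"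
    by eventually_elim (use A(2) cov in blast)
  then show False using F(1) by (simp add: eventually_False)
qed

section \<open>Covers and stars\<close>

lemma St_iter_0 [simp]: "St_iter 0 A \<U> = A"
  by (simp add: St_iter_def)

lemma St_iter_Suc [simp]: "St_iter (Suc m) A \<U> = St (St_iter m A \<U>) \<U>"
  by (simp add: St_iter_def)

lemma St_mono: "A \<subseteq> B \<Longrightarrow> St A \<U> \<subseteq> St B \<U>"
  unfolding St_def by blast

lemma cover_of_subset: "cover_of X \<U> \<Longrightarrow> U \<in> \<U> \<Longrightarrow> U \<subseteq> X"
  unfolding cover_of_def by blast

lemma cover_ofE:
  assumes "cover_of X \<U>" "x \<in> X"
  obtains U where "U \<in> \<U>" "x \<in> U"
  using assms unfolding cover_of_def by blast

lemma cover_of_if_refined: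
  assumes "cover_of X \<V>" "refines \<V> \<U>" "\<And>U. U \<in> \<U> \<Longrightarrow> U \<subseteq> X"
  shows "cover_of X \<U>"
  unfolding cover_of_def
proof (intro conjI subset_antisym)
  show "X \<subseteq> \<Union>\<U>"
  proof
    fix x assume "x \<in> X"
    with assms(1) obtain V where V: "V \<in> \<V>" "x \<in> V" by (rule cover_ofE)
    then obtain U where "U \<in> \<U>" "V \<subseteq> U" using assms(2) unfolding refines_def by meson
    then show "x \<in> \<Union>\<U>" using V(2) by auto
  qed
qed (use assms(3) in auto)

lemma star_refinesE:
  assumes "star_refines \<V> \<U>" "V \<in> \<V>"
  obtains U where "U \<in> \<U>" "St V \<V> \<subseteq> U"
  using assms by (force simp: star_refines_def refines_def)

lemma St_subset: "cover_of X \<U> \<Longrightarrow> St A \<U> \<subseteq> X"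
  unfolding cover_of_def St_def by auto

lemma in_St: "cover_of X \<U> \<Longrightarrow> x \<in> X \<Longrightarrow> x \<in> St {x} \<U>"
  unfolding cover_of_def St_def by auto

lemma member_subset_St: "U \<in> \<U> \<Longrightarrow> U \<inter> A \<noteq> {} \<Longrightarrow> U \<subseteq> St A \<U>"
  unfolding St_def by auto

lemma St_point_subset: "x \<in> A \<Longrightarrow> St {x} \<U> \<subseteq> St A \<U>"
  by (rule St_mono) simp

lemma in_St_singleton: "y \<in> St {x} \<U> \<longleftrightarrow> (\<exists>U\<in>\<U>. x \<in> U \<and> y \<in> U)"
  unfolding St_def by auto

lemma refines_inter:
  assumes "refines \<W> \<U>" "refines \<W> \<V>"
  shows "refines \<W> ((\<lambda>(U, V). U \<inter> V) ` (\<U> \<times> \<V>))"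
  unfolding refines_def
proof
  fix W assume "W \<in> \<W>"
  then obtain U V where "U \<in> \<U>" "V \<in> \<V>" "W \<subseteq> U" "W \<subseteq> V"
    using assms unfolding refines_def by meson
  then show "\<exists>A\<in>(\<lambda>(U, V). U \<inter> V) ` (\<U> \<times> \<V>). W \<subseteq> A"
    by (intro bexI[of _ "U \<inter> V"]) auto
qed

section \<open>From completeness to uniform local compactness\<close>

text \<open>The common ground of a Hausdorff uniformity and its star-finite modification. Instead of
  star-refinements, only the regularity of the induced topology is required.\<close>

locale covering_structure =
  fixes X :: "'a set" and \<nu> :: "'a set set set"
  assumes nonempty: "\<nu> \<noteq> {}"
    and cover: "\<U> \<in> \<nu> \<Longrightarrow> cover_of X \<U>"
    and upward: "\<V> \<in> \<nu> \<Longrightarrow> cover_of X \<U> \<Longrightarrow> refines \<V> \<U> \<Longrightarrow> \<U> \<in> \<nu>"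
    and topspace_eq: "topspace (uniform_topology X \<nu>) = X"
    and Hausdorff: "Hausdorff_space (uniform_topology X \<nu>)"
    and regular: "regular_space (uniform_topology X \<nu>)"
begin

abbreviation "T \<equiv> uniform_topology X \<nu>"

lemma cofinally_complete_if_Bourbaki:
  assumes "cofinally_Bourbaki_complete X \<nu>"
  shows "cofinally_complete X \<nu>"
proof -
  have "cofinally_Bourbaki_Cauchy \<nu> F" if "cofinally_Cauchy \<nu> F" for F
    using that unfolding cofinally_Cauchy_def cofinally_Bourbaki_Cauchy_def
    by (metis St_iter_0)
  then show ?thesis
    using assms unfolding cofinally_complete_def cofinally_Bourbaki_complete_def by blast
qed

lemma uniform_cover_closures:
  assumes "\<U> \<in> \<nu>"
  shows "(closure_of) T ` \<U> \<in> \<nu>"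
proof (rule upward[OF assms])
  have "U \<subseteq> T closure_of U" if "U \<in> \<U>" for U
    using cover_of_subset[OF cover[OF assms] that] by (simp add: closure_of_subset topspace_eq)
  then show r: "refines \<U> ((closure_of) T ` \<U>)"
    unfolding refines_def by auto
  show "cover_of X ((closure_of) T ` \<U>)"
    using cover[OF assms] r
    by (rule cover_of_if_refined) (use closure_of_subset_topspace[of T] topspace_eq in auto)
qed

lemma compactin_closure_of:
  assumes "compactin T K" "A \<subseteq> K"
  shows "compactin T (T closure_of A)"
proof (rule closed_compactin[OF assms(1)])
  show "T closure_of A \<subseteq> K"
    using assms(2) compactin_imp_closedin[OF Hausdorff assms(1)] by (rule closure_of_minimal)
qed (rule closedin_closure_of)

lemma uniformly_locally_compact_if_relatively_compact_cover:
  assumes "\<U> \<in> \<nu>" "\<And>U. U \<in> \<U> \<Longrightarrow> \<exists>K. compactin T K \<and> U \<subseteq> K"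
  shows "uniformly_locally_satisfies compact_subset X \<nu>"
  unfolding uniformly_locally_satisfies_def compact_subset_def
proof (intro bexI[OF _ uniform_cover_closures[OF assms(1)]] ballI)
  fix V assume "V \<in> (closure_of) T ` \<U>"
  then obtain U where U: "U \<in> \<U>" "V = T closure_of U" by (elim imageE)
  from assms(2)[OF U(1)] obtain K where "compactin T K" "U \<subseteq> K" by (elim exE conjE)
  then show "compactin T V" unfolding U(2) by (rule compactin_closure_of)
qed

lemma uniformly_locally_compact_if_cofinally_complete:
  assumes lc: "locally_compact_space T" and cc: "cofinally_complete X \<nu>"
  shows "uniformly_locally_satisfies compact_subset X \<nu>"
proof (rule ccontr)
  assume neg: "\<not> ?thesis"
  have ex: "\<exists>U\<in>\<U>. \<forall>K. compactin T K \<longrightarrow> \<not> U \<subseteq> K" if "\<U> \<in> \<nu>" for \<U>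
    using neg uniformly_locally_compact_if_relatively_compact_cover[OF that] by blast
  \<comment> \<open>The filter generated by the complements of the compact sets.\<close>
  define F where "F = (INF K\<in>{K. compactin T K}. principal (X - K))"
  have ev: "eventually P F \<longleftrightarrow> (\<exists>K. compactin T K \<and> (\<forall>x\<in>X - K. P x))" for P
  proof -
    have "eventually P F \<longleftrightarrow> (\<exists>K\<in>{K. compactin T K}. eventually P (principal (X - K)))"
      unfolding F_def
    proof (rule eventually_INF_base)
      show "{K. compactin T K} \<noteq> {}" using compactin_empty by blast
      fix K L assume "K \<in> {K. compactin T K}" "L \<in> {K. compactin T K}"
      then show "\<exists>M\<in>{K. compactin T K}. principal (X - M)
          \<le> inf (principal (X - K)) (principal (X - L))"
        by (intro bexI[of _ "K \<union> L"]) (auto intro: compactin_Un)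
    qed
    then show ?thesis by (simp add: eventually_principal)
  qed
  have meets: "A \<inter> U \<noteq> {}"
    if A: "eventually (\<lambda>x. x \<in> A) F" and U: "\<And>K. compactin T K \<Longrightarrow> \<not> U \<subseteq> K" "U \<subseteq> X" for A U
    using A U unfolding ev by blast
  have sub: "U \<subseteq> X" if "\<U> \<in> \<nu>" "U \<in> \<U>" for \<U> U
    using cover[OF that(1)] that(2) unfolding cover_of_def by blast
  have "F \<noteq> bot"
  proof
    assume "F = bot"
    then have "eventually (\<lambda>x. x \<in> {}) F" by simp
    then show False using nonempty ex meets sub by blast
  qed
  moreover have "F \<le> principal X"
    unfolding le_principal ev using compactin_empty by blast
  moreover have "cofinally_Cauchy \<nu> F"
    unfolding cofinally_Cauchy_def using ex meets sub by meson
  ultimately obtain x where x: "x \<in> X" "cluster_point T F x"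
    using cc unfolding cofinally_complete_def filter_on_def by blast
  obtain W K where W: "openin T W" "compactin T K" "x \<in> W" "W \<subseteq> K"
    using lc x(1) unfolding locally_compact_space_def topspace_eq by blast
  have "eventually (\<lambda>y. y \<in> X - K) F" unfolding ev using W(2) by blast
  then have "x \<in> T closure_of (X - K)" using x(2) unfolding cluster_point_def by blast
  then have "W \<inter> (X - K) \<noteq> {}" using W(1,3) unfolding in_closure_of by blast
  then show False using W(4) by blast
qed

text \<open>It suffices that the closed subsets of the sets with property \<open>P\<close> are compact, because by
  regularity each point has a closed neighbourhood inside any given neighbourhood.\<close>

lemma locally_compact_if_locally_satisfies:
  assumes loc: "locally_satisfies P X \<nu>"
    and comp: "\<And>N C. P X \<nu> N \<Longrightarrow> C \<subseteq> N \<Longrightarrow> closedin T C \<Longrightarrow> compactin T C"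
  shows "locally_compact_space T"
  unfolding locally_compact_space_def topspace_eq
proof
  fix x assume "x \<in> X"
  then obtain W N where W: "openin T W" "x \<in> W" "W \<subseteq> N" "P X \<nu> N"
    using loc unfolding locally_satisfies_def by meson
  have "neighbourhood_base_of (closedin T) T"
    using regular by (rule iffD2[OF neighbourhood_base_of_closedin])
  from iffD1[OF neighbourhood_base_of this, rule_format, OF conjI[OF W(1,2)]]
  obtain U C where "openin T U" "closedin T C" "x \<in> U" "U \<subseteq> C" "C \<subseteq> W" by (elim exE conjE)
  then show "\<exists>U K. openin T U \<and> compactin T K \<and> x \<in> U \<and> U \<subseteq> K"
    using comp[OF W(4), of C] W(3) by (intro exI[of _ U] exI[of _ C]) auto
qed

lemma uniformly_locally_compact_if_totally_bounded:
  assumes loc: "locally_satisfies totally_bounded_subset X \<nu>" and cc: "cofinally_complete X \<nu>"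
  shows "uniformly_locally_satisfies compact_subset X \<nu>"
proof (rule uniformly_locally_compact_if_cofinally_complete[OF _ cc],
    rule locally_compact_if_locally_satisfies[OF loc])
  fix N C assume N: "totally_bounded_subset X \<nu> N" "C \<subseteq> N" and C: "closedin T C"
  have CX: "C \<subseteq> X" using closedin_subset[OF C] topspace_eq by simp
  show "compactin T C"
  proof (rule compactin_if_cluster_points[OF C])
    fix F assume F: "F \<noteq> bot" "F \<le> principal C"
    have "cofinally_Cauchy \<nu> F"
      unfolding cofinally_Cauchy_def
    proof
      fix \<U> assume "\<U> \<in> \<nu>"
      then obtain \<F> where "\<F> \<subseteq> \<U>" "finite \<F>" "C \<subseteq> \<Union>\<F>"
        using N unfolding totally_bounded_subset_def by (meson subset_trans)
      then show "\<exists>U\<in>\<U>. \<forall>A. eventually (\<lambda>x. x \<in> A) F \<longrightarrow> A \<inter> U \<noteq> {}"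
        using finite_cover_meets_filter[OF F, of \<F> "\<lambda>U. U"] by auto
    qed
    moreover have "filter_on X F"
      using F(1) order_trans[OF F(2), of "principal X"] CX unfolding filter_on_def by simp
    ultimately show "\<exists>x. cluster_point T F x"
      using cc unfolding cofinally_complete_def by blast
  qed
qed

lemma uniformly_locally_compact_if_Bourbaki_bounded:
  assumes loc: "locally_satisfies Bourbaki_bounded_subset X \<nu>"
    and cc: "cofinally_Bourbaki_complete X \<nu>"
  shows "uniformly_locally_satisfies compact_subset X \<nu>"
proof (rule uniformly_locally_compact_if_cofinally_complete[OF _ cofinally_complete_if_Bourbaki[OF cc]],
    rule locally_compact_if_locally_satisfies[OF loc])
  fix N C assume N: "Bourbaki_bounded_subset X \<nu> N" "C \<subseteq> N" and C: "closedin T C"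
  have CX: "C \<subseteq> X" using closedin_subset[OF C] topspace_eq by simp
  show "compactin T C"
  proof (rule compactin_if_cluster_points[OF C])
    fix F assume F: "F \<noteq> bot" "F \<le> principal C"
    have "cofinally_Bourbaki_Cauchy \<nu> F"
      unfolding cofinally_Bourbaki_Cauchy_def
    proof
      fix \<U> assume "\<U> \<in> \<nu>"
      then obtain m \<F> where *: "\<F> \<subseteq> \<U>" "finite \<F>" "N \<subseteq> (\<Union>U\<in>\<F>. St_iter m U \<U>)"
        using bspec[OF conjunct2[OF N(1)[unfolded Bourbaki_bounded_subset_def]]] by meson
      from finite_cover_meets_filter[OF F *(2) subset_trans[OF N(2) *(3)]]
      obtain U where U: "U \<in> \<F>"
          "\<forall>A. eventually (\<lambda>x. x \<in> A) F \<longrightarrow> A \<inter> St_iter m U \<U> \<noteq> {}"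
        by (elim bexE)
      have "U \<in> \<U>" using U(1) *(1) by (rule rev_subsetD)
      with U(2) show "\<exists>m. \<exists>U\<in>\<U>. \<forall>A. eventually (\<lambda>x. x \<in> A) F \<longrightarrow> A \<inter> St_iter m U \<U> \<noteq> {}"
        by (intro exI bexI)
    qed
    moreover have "filter_on X F"
      using F(1) order_trans[OF F(2), of "principal X"] CX unfolding filter_on_def by simp
    ultimately show "\<exists>x. cluster_point T F x"
      using cc unfolding cofinally_Bourbaki_complete_def by blast
  qed
qed

section \<open>Covers with relatively compact stars\<close>

text \<open>A compact set is covered by finitely many members of the cover, and its star by the stars of
  these members.\<close>

lemma St_relatively_compact:
  assumes op: "\<And>V. V \<in> \<V> \<Longrightarrow> openin T V" and cov: "cover_of X \<V>"
    and star: "\<And>V. V \<in> \<V> \<Longrightarrow> \<exists>K. compactin T K \<and> St V \<V> \<subseteq> K"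
    and K: "compactin T K"
  shows "\<exists>L. compactin T L \<and> St K \<V> \<subseteq> L"
proof -
  have "K \<subseteq> \<Union>\<V>"
    using compactin_subset_topspace[OF K] cov by (simp add: topspace_eq cover_of_def)
  then obtain \<F> where F: "finite \<F>" "\<F> \<subseteq> \<V>" "K \<subseteq> \<Union>\<F>"
    using compactinD[OF K op] by metis
  obtain L where L: "\<And>V. V \<in> \<V> \<Longrightarrow> compactin T (L V)" "\<And>V. V \<in> \<V> \<Longrightarrow> St V \<V> \<subseteq> L V"
    using star by metis
  have "compactin T (\<Union>(L ` \<F>))"
    using F L(1) by (intro compactin_Union) auto
  moreover have "St K \<V> \<subseteq> (\<Union>V\<in>\<F>. St V \<V>)"
    using F(3) unfolding St_def by blast
  then have "St K \<V> \<subseteq> \<Union>(L ` \<F>)" using L(2) F(2) by blast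
  ultimately show ?thesis by blast
qed

lemma St_iter_relatively_compact:
  assumes op: "\<And>V. V \<in> \<V> \<Longrightarrow> openin T V" and cov: "cover_of X \<V>"
    and star: "\<And>V. V \<in> \<V> \<Longrightarrow> \<exists>K. compactin T K \<and> St V \<V> \<subseteq> K"
    and A: "\<exists>K. compactin T K \<and> A \<subseteq> K"
  shows "\<exists>L. compactin T L \<and> St_iter m A \<V> \<subseteq> L"
proof (induction m)
  case 0
  show ?case using A by simp
next
  case (Suc m)
  then obtain K where K: "compactin T K" "St_iter m A \<V> \<subseteq> K" by blast
  then obtain L where "compactin T L" "St K \<V> \<subseteq> L"
    using St_relatively_compact[OF op cov star] by metis
  then show ?case using St_mono[OF K(2), of \<V>] by auto
qed

lemma cofinally_Bourbaki_complete_if_relatively_compact_stars: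
  assumes V: "\<V> \<in> \<nu>" and op: "\<And>V. V \<in> \<V> \<Longrightarrow> openin T V"
    and star: "\<And>V. V \<in> \<V> \<Longrightarrow> \<exists>K. compactin T K \<and> St V \<V> \<subseteq> K"
  shows "cofinally_Bourbaki_complete X \<nu>"
  unfolding cofinally_Bourbaki_complete_def
proof (intro allI impI)
  fix F assume F: "filter_on X F \<and> cofinally_Bourbaki_Cauchy \<nu> F"
  then obtain m U where U: "U \<in> \<V>"
      "\<And>A. eventually (\<lambda>x. x \<in> A) F \<Longrightarrow> A \<inter> St_iter m U \<V> \<noteq> {}"
    using V unfolding cofinally_Bourbaki_Cauchy_def by blast
  have "U \<subseteq> St U \<V>" using U(1) unfolding St_def by blast
  then have "\<exists>K. compactin T K \<and> U \<subseteq> K" using star[OF U(1)] by blast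
  then obtain L where L: "compactin T L" "St_iter m U \<V> \<subseteq> L"
    using St_iter_relatively_compact[OF op cover[OF V] star] by metis
  then obtain x where "x \<in> L" "cluster_point T F x"
    using compactin_meets_imp_cluster_point[OF L(1), of F] U(2) by blast
  then show "\<exists>x\<in>X. cluster_point T F x"
    using compactin_subset_topspace[OF L(1)] by (auto simp: topspace_eq)
qed

end

section \<open>The topology of a covering uniformity\<close>

context
  fixes X :: "'a set" and \<mu> :: "'a set set set"
  assumes u: "covering_uniformity X \<mu>"
begin

lemma
  shows uniform_nonempty: "\<mu> \<noteq> {}"
    and uniform_cover: "\<And>\<U>. \<U> \<in> \<mu> \<Longrightarrow> cover_of X \<U>"
    and uniform_cover_coarser: "\<And>\<U> \<V>. \<V> \<in> \<mu> \<Longrightarrow> cover_of X \<U> \<Longrightarrow> refines \<V> \<U> \<Longrightarrow> \<U> \<in> \<mu>"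
    and uniform_common_refinement_ex: "\<And>\<U> \<V>. \<U> \<in> \<mu> \<Longrightarrow> \<V> \<in> \<mu> \<Longrightarrow>
      \<exists>\<W>\<in>\<mu>. star_refines \<W> \<U> \<and> star_refines \<W> \<V>"
proof -
  note d = u[unfolded covering_uniformity_def]
  note c = conjunct2[OF d] and r = conjunct2[OF conjunct2[OF d]]
  show "\<mu> \<noteq> {}" using d by (rule conjunct1)
  show "cover_of X \<U>" if "\<U> \<in> \<mu>" for \<U> using conjunct1[OF c] that by (rule bspec)
  show "\<U> \<in> \<mu>" if "\<V> \<in> \<mu>" "cover_of X \<U>" "refines \<V> \<U>" for \<U> \<V>
    using conjunct1[OF r, rule_format, OF that(1) conjI[OF that(2,3)]] .
  show "\<exists>\<W>\<in>\<mu>. star_refines \<W> \<U> \<and> star_refines \<W> \<V>" if "\<U> \<in> \<mu>" "\<V> \<in> \<mu>" for \<U> \<V>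
    using conjunct2[OF r, rule_format, OF that] .
qed

lemma uniform_common_refinement:
  assumes "\<U> \<in> \<mu>" "\<V> \<in> \<mu>"
  obtains \<W> where "\<W> \<in> \<mu>" "star_refines \<W> \<U>" "star_refines \<W> \<V>"
  using uniform_common_refinement_ex[OF assms] that by (elim bexE conjE)

lemma uniform_star_refinement:
  assumes "\<U> \<in> \<mu>"
  obtains \<W> where "\<W> \<in> \<mu>" "star_refines \<W> \<U>"
  using uniform_common_refinement[OF assms assms] .

end

lemma interior_of_uniform_topology:
  assumes u: "covering_uniformity X \<mu>" and U: "\<U> \<in> \<mu>" and x: "x \<in> X" "St {x} \<U> \<subseteq> A"
  shows "x \<in> uniform_topology X \<mu> interior_of A"
proof -
  \<comment> \<open>By star-refinement, the points with a uniform star inside \<open>A\<close> form an open set.\<close>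
  define B where "B = {y \<in> X. \<exists>\<U>\<in>\<mu>. St {y} \<U> \<subseteq> A}"
  have "openin (uniform_topology X \<mu>) B"
    unfolding openin_uniform_topology(1)[OF u]
  proof (intro conjI ballI)
    fix y assume "y \<in> B"
    then obtain \<V> where V: "\<V> \<in> \<mu>" "St {y} \<V> \<subseteq> A" unfolding B_def by blast
    obtain \<W> where W: "\<W> \<in> \<mu>" "star_refines \<W> \<V>" by (rule uniform_star_refinement[OF u V(1)])
    have "St {z} \<W> \<subseteq> A" "z \<in> X" if z: "z \<in> St {y} \<W>" for z
    proof -
      obtain Z where Z: "Z \<in> \<W>" "y \<in> Z" "z \<in> Z" using z unfolding in_St_singleton by auto
      obtain V where V': "V \<in> \<V>" "St Z \<W> \<subseteq> V" using W(2) Z(1) by (rule star_refinesE)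
      have "Z \<subseteq> St Z \<W>" using Z(1,2) by (intro member_subset_St) auto
      then have "y \<in> V" using V'(2) Z(2) by auto
      then have "V \<subseteq> St {y} \<V>" using V'(1) by (intro member_subset_St) auto
      then show "St {z} \<W> \<subseteq> A" using St_point_subset[OF Z(3)] V'(2) V(2) by (meson subset_trans)
      show "z \<in> X" using cover_of_subset[OF uniform_cover[OF u W(1)] Z(1)] Z(3) by auto
    qed
    then have "St {y} \<W> \<subseteq> B" unfolding B_def using W(1) by auto
    then show "\<exists>\<U>\<in>\<mu>. St {y} \<U> \<subseteq> B" using W(1) by (rule bexI)
  qed (auto simp: B_def)
  moreover have "B \<subseteq> A"
  proof
    fix y assume "y \<in> B"
    then obtain \<V> where "y \<in> X" "\<V> \<in> \<mu>" "St {y} \<V> \<subseteq> A" unfolding B_def by blast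
    then show "y \<in> A" using in_St[OF uniform_cover[OF u]] by auto
  qed
  moreover have "x \<in> B" unfolding B_def using x U by blast
  ultimately show ?thesis by (meson interior_of_maximal subsetD)
qed

lemma closure_of_St_subset:
  assumes u: "covering_uniformity X \<mu>" and V: "\<V> \<in> \<mu>" "star_refines \<V> \<U>"
  shows "uniform_topology X \<mu> closure_of St {x} \<V> \<subseteq> St {x} \<U>"
proof
  fix y assume y: "y \<in> uniform_topology X \<mu> closure_of St {x} \<V>"
  then have "y \<in> X" by (simp add: in_closure_of openin_uniform_topology(2)[OF u])
  then have "y \<in> uniform_topology X \<mu> interior_of St {y} \<V>"
    using interior_of_uniform_topology[OF u V(1)] by blast
  then obtain z where "z \<in> St {x} \<V>" "z \<in> uniform_topology X \<mu> interior_of St {y} \<V>"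
    using y openin_interior_of unfolding in_closure_of by meson
  then have "St {x} \<V> \<inter> St {y} \<V> \<noteq> {}"
    using interior_of_subset[of "uniform_topology X \<mu>" "St {y} \<V>"] by auto
  then obtain z where "z \<in> St {x} \<V>" "z \<in> St {y} \<V>" by auto
  then obtain V W where VW: "V \<in> \<V>" "x \<in> V" "z \<in> V" "W \<in> \<V>" "y \<in> W" "z \<in> W"
    unfolding in_St_singleton by auto
  obtain U where U: "U \<in> \<U>" "St V \<V> \<subseteq> U" using V(2) VW(1) by (rule star_refinesE)
  have "V \<subseteq> St V \<V>" "W \<subseteq> St V \<V>" using VW unfolding St_def by auto
  then show "y \<in> St {x} \<U>" unfolding in_St_singleton using U VW by (intro bexI[of _ U]) auto
qed

lemma regular_space_uniform_topology:
  assumes u: "covering_uniformity X \<mu>"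
  shows "regular_space (uniform_topology X \<mu>)"
proof (rule iffD1[OF neighbourhood_base_of_closedin], unfold neighbourhood_base_of, intro allI impI)
  let ?T = "uniform_topology X \<mu>"
  fix W x assume W: "openin ?T W \<and> x \<in> W"
  then have "x \<in> X" "\<exists>\<U>\<in>\<mu>. St {x} \<U> \<subseteq> W"
    unfolding openin_uniform_topology(1)[OF u] by auto
  then obtain \<U> where U: "x \<in> X" "\<U> \<in> \<mu>" "St {x} \<U> \<subseteq> W" by blast
  obtain \<V> where V: "\<V> \<in> \<mu>" "star_refines \<V> \<U>" by (rule uniform_star_refinement[OF u U(2)])
  have "St {x} \<V> \<subseteq> topspace ?T"
    unfolding openin_uniform_topology(2)[OF u] by (rule St_subset[OF uniform_cover[OF u V(1)]])
  then have "?T interior_of St {x} \<V> \<subseteq> ?T closure_of St {x} \<V>"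
    by (intro subset_trans[OF interior_of_subset] closure_of_subset)
  moreover have "?T closure_of St {x} \<V> \<subseteq> W"
    using closure_of_St_subset[OF u V] U(3) by (rule subset_trans)
  moreover have "x \<in> ?T interior_of St {x} \<V>"
    using interior_of_uniform_topology[OF u V(1) U(1) subset_refl] .
  ultimately show "\<exists>U V. openin ?T U \<and> closedin ?T V \<and> x \<in> U \<and> U \<subseteq> V \<and> V \<subseteq> W"
    by (intro exI[of _ "?T interior_of St {x} \<V>"] exI[of _ "?T closure_of St {x} \<V>"] conjI
      openin_interior_of closedin_closure_of)
qed

lemma covering_structure_uniformity:
  assumes "Hausdorff_uniform_space X \<mu>"
  shows "covering_structure X \<mu>"
proof -
  have u: "covering_uniformity X \<mu>" and H: "Hausdorff_space (uniform_topology X \<mu>)"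
    using assms unfolding Hausdorff_uniform_space_def by auto
  show ?thesis
  proof
    show "\<mu> \<noteq> {}" using u by (rule uniform_nonempty)
    show "cover_of X \<U>" if "\<U> \<in> \<mu>" for \<U> using u that by (rule uniform_cover)
    show "\<U> \<in> \<mu>" if "\<V> \<in> \<mu>" "cover_of X \<U>" "refines \<V> \<U>" for \<V> \<U>
      using u that by (rule uniform_cover_coarser)
  qed (fact openin_uniform_topology(2)[OF u] H regular_space_uniform_topology[OF u])+
qed

lemma uniform_cover_interiors:
  assumes u: "covering_uniformity X \<mu>" and U: "\<U> \<in> \<mu>"
  shows "(interior_of) (uniform_topology X \<mu>) ` \<U> \<in> \<mu>"
proof -
  let ?T = "uniform_topology X \<mu>"
  obtain \<V> where V: "\<V> \<in> \<mu>" "star_refines \<V> \<U>" by (rule uniform_star_refinement[OF u U])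
  note cov = uniform_cover[OF u V(1)]
  have r: "refines \<V> ((interior_of) ?T ` \<U>)"
    unfolding refines_def
  proof
    fix V assume v: "V \<in> \<V>"
    obtain U where U: "U \<in> \<U>" "St V \<V> \<subseteq> U" using V(2) v by (rule star_refinesE)
    have "V \<subseteq> ?T interior_of U"
    proof
      fix x assume x: "x \<in> V"
      then have "x \<in> X" using cover_of_subset[OF cov v] by auto
      moreover have "St {x} \<V> \<subseteq> U" using St_point_subset[OF x] U(2) by (rule subset_trans)
      ultimately show "x \<in> ?T interior_of U" by (rule interior_of_uniform_topology[OF u V(1)])
    qed
    then show "\<exists>U\<in>(interior_of) ?T ` \<U>. V \<subseteq> U" using U(1) by auto
  qed
  have "cover_of X ((interior_of) ?T ` \<U>)"
    using cov r
  proof (rule cover_of_if_refined)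
    show "U \<subseteq> X" if "U \<in> (interior_of) ?T ` \<U>" for U
      using that interior_of_subset_topspace[of ?T] openin_uniform_topology(2)[OF u] by auto
  qed
  then show ?thesis using r by (rule uniform_cover_coarser[OF u V(1)])
qed

lemma compact_imp_totally_bounded:
  assumes u: "covering_uniformity X \<mu>" and K: "compactin (uniform_topology X \<mu>) K"
  shows "totally_bounded_subset X \<mu> K"
  unfolding totally_bounded_subset_def
proof (intro conjI ballI)
  let ?T = "uniform_topology X \<mu>"
  show KX: "K \<subseteq> X" using compactin_subset_topspace[OF K] by (simp add: openin_uniform_topology(2)[OF u])
  fix \<U> assume "\<U> \<in> \<mu>"
  then have "cover_of X ((interior_of) ?T ` \<U>)"
    by (intro uniform_cover[OF u] uniform_cover_interiors[OF u])
  then have "K \<subseteq> \<Union>((interior_of) ?T ` \<U>)" using KX by (simp only: cover_of_def)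
  moreover have "openin ?T U" if "U \<in> (interior_of) ?T ` \<U>" for U using that by auto
  ultimately obtain \<G> where "finite \<G>" "\<G> \<subseteq> (interior_of) ?T ` \<U>" "K \<subseteq> \<Union>\<G>"
    using compactinD[OF K] by metis
  then obtain \<F> where F: "finite \<F>" "\<F> \<subseteq> \<U>" "K \<subseteq> (\<Union>U\<in>\<F>. ?T interior_of U)"
    by (metis finite_subset_image)
  have "(\<Union>U\<in>\<F>. ?T interior_of U) \<subseteq> \<Union>\<F>"
    using interior_of_subset[of ?T] by auto
  with F(3) have "K \<subseteq> \<Union>\<F>" by (rule subset_trans)
  then show "\<exists>\<F>\<subseteq>\<U>. finite \<F> \<and> K \<subseteq> \<Union>\<F>" using F(1,2) by (intro exI conjI)
qed

lemma totally_bounded_imp_Bourbaki_bounded: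
  assumes "totally_bounded_subset X \<mu> B"
  shows "Bourbaki_bounded_subset X \<mu> B"
  unfolding Bourbaki_bounded_subset_def
proof (intro conjI ballI)
  show "B \<subseteq> X" using assms unfolding totally_bounded_subset_def by blast
  fix \<U> assume "\<U> \<in> \<mu>"
  then obtain \<F> where "\<F> \<subseteq> \<U>" "finite \<F>" "B \<subseteq> \<Union>\<F>"
    using assms unfolding totally_bounded_subset_def by blast
  then have "\<F> \<subseteq> \<U> \<and> finite \<F> \<and> B \<subseteq> (\<Union>U\<in>\<F>. St_iter 0 U \<U>)" by simp
  then show "\<exists>m. \<exists>\<F>\<subseteq>\<U>. finite \<F> \<and> B \<subseteq> (\<Union>U\<in>\<F>. St_iter m U \<U>)" by blast
qed

lemma locally_satisfies_mono:
  assumes "locally_satisfies P X \<mu>" "uniform_topology X \<nu> = uniform_topology X \<mu>"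
    and "\<And>B. P X \<mu> B \<Longrightarrow> Q X \<nu> B"
  shows "locally_satisfies Q X \<nu>"
  using assms unfolding locally_satisfies_def by metis

lemma locally_totally_bounded_if_uniformly_locally_compact:
  assumes u: "covering_uniformity X \<mu>" and c: "uniformly_locally_satisfies compact_subset X \<mu>"
  shows "locally_satisfies totally_bounded_subset X \<mu>"
  unfolding locally_satisfies_def
proof
  let ?T = "uniform_topology X \<mu>"
  fix x assume x: "x \<in> X"
  obtain \<U> where U: "\<U> \<in> \<mu>" "\<And>U. U \<in> \<U> \<Longrightarrow> compactin ?T U"
    using c unfolding uniformly_locally_satisfies_def compact_subset_def by blast
  have "cover_of X ((interior_of) ?T ` \<U>)"
    by (intro uniform_cover[OF u] uniform_cover_interiors[OF u] U(1))
  then obtain S where "S \<in> (interior_of) ?T ` \<U>" "x \<in> S" using x by (rule cover_ofE)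
  then obtain V where V: "V \<in> \<U>" "x \<in> ?T interior_of V" by auto
  have tb: "totally_bounded_subset X \<mu> V"
    by (rule compact_imp_totally_bounded[OF u U(2)[OF V(1)]])
  then have "V \<subseteq> X" by (simp add: totally_bounded_subset_def)
  then show "\<exists>W N. openin ?T W \<and> x \<in> W \<and> W \<subseteq> N \<and> N \<subseteq> X \<and> totally_bounded_subset X \<mu> N"
    using tb by (intro exI[of _ "?T interior_of V"] exI[of _ V] conjI openin_interior_of V(2) interior_of_subset)
qed

section \<open>The star-finite modification\<close>

lemma star_finite_open_cover_inter:
  assumes u: "covering_uniformity X \<mu>"
    and U: "\<U> \<in> star_finite_open_covers X \<mu>" and V: "\<V> \<in> star_finite_open_covers X \<mu>"
  shows "(\<lambda>(U, V). U \<inter> V) ` (\<U> \<times> \<V>) \<in> star_finite_open_covers X \<mu>" (is "?I \<in> _")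
proof -
  have mem: "\<U> \<in> \<mu>" "\<V> \<in> \<mu>" and sf: "star_finite \<U>" "star_finite \<V>"
    and op: "\<And>U. U \<in> \<U> \<Longrightarrow> openin (uniform_topology X \<mu>) U"
      "\<And>V. V \<in> \<V> \<Longrightarrow> openin (uniform_topology X \<mu>) V"
    using U V unfolding star_finite_open_covers_def by auto
  obtain \<W> where W: "\<W> \<in> \<mu>" "star_refines \<W> \<U>" "star_refines \<W> \<V>"
    using uniform_common_refinement[OF u mem] .
  have r: "refines \<W> ?I"
    using W(2,3) by (intro refines_inter star_refines_imp_refines)
  have "cover_of X ?I"
    using uniform_cover[OF u W(1)] r
  proof (rule cover_of_if_refined)
    show "A \<subseteq> X" if "A \<in> ?I" for A
      using that cover_of_subset[OF uniform_cover[OF u mem(1)]] by auto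
  qed
  then have "?I \<in> \<mu>" using r by (rule uniform_cover_coarser[OF u W(1)])
  moreover have "star_finite ?I"
    unfolding star_finite_def
  proof
    fix A assume "A \<in> ?I"
    then obtain U V where UV: "U \<in> \<U>" "V \<in> \<V>" "A = U \<inter> V" by blast
    have "{B \<in> ?I. A \<inter> B \<noteq> {}} \<subseteq>
        (\<lambda>(U, V). U \<inter> V) ` ({U' \<in> \<U>. U \<inter> U' \<noteq> {}} \<times> {V' \<in> \<V>. V \<inter> V' \<noteq> {}})"
      unfolding UV(3) by auto
    moreover have "finite \<dots>" using sf UV(1,2) unfolding star_finite_def by blast
    ultimately show "finite {B \<in> ?I. A \<inter> B \<noteq> {}}" by (rule finite_subset)
  qed
  moreover have "\<forall>A\<in>?I. openin (uniform_topology X \<mu>) A" using op by auto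
  ultimately show ?thesis unfolding star_finite_open_covers_def by simp
qed

lemma sf_uniformity_subset:
  assumes "covering_uniformity X \<mu>"
  shows "sf_uniformity X \<mu> \<subseteq> \<mu>"
  using uniform_cover_coarser[OF assms] by (auto simp: sf_uniformity_def star_finite_open_covers_def)

lemma star_finite_open_covers_subset_sf:
  assumes "covering_uniformity X \<mu>"
  shows "star_finite_open_covers X \<mu> \<subseteq> sf_uniformity X \<mu>"
proof
  fix \<U> assume U: "\<U> \<in> star_finite_open_covers X \<mu>"
  then have "cover_of X \<U>" using uniform_cover[OF assms] by (simp add: star_finite_open_covers_def)
  moreover have "refines \<U> \<U>" unfolding refines_def by auto
  ultimately show "\<U> \<in> sf_uniformity X \<mu>" using U unfolding sf_uniformity_def by auto
qed

text \<open>The cover consists of \<open>W\<close> and the complement of the closure of a star at \<open>x\<close>. It is uniform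
  if that star belongs to a star-refinement of a star-refinement of a uniform cover whose star
  at \<open>x\<close> lies in \<open>W\<close>.\<close>

lemma finite_open_cover_at_point:
  assumes u: "covering_uniformity X \<mu>" and W: "openin (uniform_topology X \<mu>) W" "x \<in> W"
  shows "\<exists>\<V>\<in>star_finite_open_covers X \<mu>. St {x} \<V> \<subseteq> W"
proof -
  let ?T = "uniform_topology X \<mu>"
  note top = openin_uniform_topology[OF u]
  have WX: "W \<subseteq> X" using W(1) unfolding top by simp
  have "\<exists>\<U>\<in>\<mu>. St {x} \<U> \<subseteq> W" using W unfolding top by simp
  then obtain \<U> where U: "\<U> \<in> \<mu>" "St {x} \<U> \<subseteq> W" by blast
  obtain \<V> where V: "\<V> \<in> \<mu>" "star_refines \<V> \<U>" by (rule uniform_star_refinement[OF u U(1)])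
  obtain \<W> where W': "\<W> \<in> \<mu>" "star_refines \<W> \<V>" by (rule uniform_star_refinement[OF u V(1)])
  note cov = uniform_cover[OF u V(1)] uniform_cover[OF u W'(1)]
  define C where "C = ?T closure_of St {x} \<W>"
  have CV: "C \<subseteq> St {x} \<V>" unfolding C_def using closure_of_St_subset[OF u W'] .
  have r: "refines \<V> {W, X - C}"
    unfolding refines_def
  proof
    fix V assume v: "V \<in> \<V>"
    show "\<exists>U\<in>{W, X - C}. V \<subseteq> U"
    proof (cases "V \<inter> C = {}")
      case True
      then show ?thesis using cover_of_subset[OF cov(1) v] by auto
    next
      case False
      then obtain z where "z \<in> V" "z \<in> St {x} \<V>" using CV by auto
      then obtain Z where Z: "Z \<in> \<V>" "x \<in> Z" "z \<in> Z" "z \<in> V" unfolding in_St_singleton by auto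
      obtain U where U': "U \<in> \<U>" "St Z \<V> \<subseteq> U" using V(2) Z(1) by (rule star_refinesE)
      have "Z \<subseteq> St Z \<V>" "V \<subseteq> St Z \<V>" using Z v unfolding St_def by auto
      moreover have "U \<subseteq> St {x} \<U>" if "x \<in> U" using U'(1) that by (intro member_subset_St) auto
      ultimately have "V \<subseteq> W" using U' U(2) Z(2) by (meson subset_iff)
      then show ?thesis by simp
    qed
  qed
  have "cover_of X {W, X - C}"
    using cov(1) r by (rule cover_of_if_refined) (use WX in auto)
  then have "{W, X - C} \<in> \<mu>" using r by (rule uniform_cover_coarser[OF u V(1)])
  moreover have "openin ?T (X - C)" unfolding C_def by (metis closedin_closure_of closedin_def top(2))
  moreover have "star_finite {W, X - C}"
    unfolding star_finite_def by (simp add: finite_subset[of _ "{W, X - C}"])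
  ultimately have "{W, X - C} \<in> star_finite_open_covers X \<mu>"
    using W(1) unfolding star_finite_open_covers_def by simp
  moreover have "x \<in> C"
  proof -
    have "x \<in> X" using W(2) WX by auto
    then have "x \<in> St {x} \<W>" by (rule in_St[OF cov(2)])
    moreover have "St {x} \<W> \<subseteq> topspace ?T" unfolding top(2) by (rule St_subset[OF cov(2)])
    ultimately show ?thesis unfolding C_def using closure_of_subset by (meson subsetD)
  qed
  then have "St {x} {W, X - C} \<subseteq> W" unfolding St_def by auto
  ultimately show ?thesis by (intro bexI)
qed

lemma
  assumes u: "covering_uniformity X \<mu>"
  shows sf_uniformity_nonempty: "sf_uniformity X \<mu> \<noteq> {}"
    and uniform_topology_sf: "uniform_topology X (sf_uniformity X \<mu>) = uniform_topology X \<mu>"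
proof -
  let ?s = "sf_uniformity X \<mu>" and ?T = "uniform_topology X \<mu>"
  note top = openin_uniform_topology[OF u]
  obtain \<U> where U: "\<U> \<in> \<mu>" using uniform_nonempty[OF u] by auto
  have "refines \<U> {X}" using cover_of_subset[OF uniform_cover[OF u U]] unfolding refines_def by auto
  moreover have "cover_of X {X}" unfolding cover_of_def by auto
  ultimately have "{X} \<in> \<mu>" by (intro uniform_cover_coarser[OF u U])
  moreover have "openin ?T X" using openin_topspace[of ?T] unfolding top(2) .
  moreover have "star_finite {X}"
    unfolding star_finite_def by (simp add: finite_subset[of _ "{X}"])
  ultimately have "{X} \<in> star_finite_open_covers X \<mu>" unfolding star_finite_open_covers_def by simp
  then show ne: "?s \<noteq> {}" using star_finite_open_covers_subset_sf[OF u] by auto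
  have dir: "\<exists>\<W>\<in>?s. refines \<W> \<U> \<and> refines \<W> \<V>" if UV: "\<U> \<in> ?s" "\<V> \<in> ?s" for \<U> \<V>
  proof -
    obtain \<A> \<B> where AB: "\<A> \<in> star_finite_open_covers X \<mu>" "refines \<A> \<U>"
        "\<B> \<in> star_finite_open_covers X \<mu>" "refines \<B> \<V>"
      using UV unfolding sf_uniformity_def by auto
    let ?I = "(\<lambda>(U, V). U \<inter> V) ` (\<A> \<times> \<B>)"
    have "refines ?I \<A>" "refines ?I \<B>" unfolding refines_def by auto
    then have "refines ?I \<U>" "refines ?I \<V>" using AB(2,4) by (auto intro: refines_trans)
    moreover have "?I \<in> ?s"
      using star_finite_open_covers_subset_sf[OF u] star_finite_open_cover_inter[OF u AB(1,3)]
      by (rule subsetD)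
    ultimately show ?thesis by (intro bexI conjI)
  qed
  have cov: "cover_of X \<U>" if "\<U> \<in> ?s" for \<U> using that by (simp add: sf_uniformity_def)
  have stop: "openin (uniform_topology X ?s) W \<longleftrightarrow> W \<subseteq> X \<and> (\<forall>x\<in>W. \<exists>\<U>\<in>?s. St {x} \<U> \<subseteq> W)" for W
    by (rule openin_uniform_topology_directed(1)[OF ne]) (rule cov dir; assumption)+
  show "uniform_topology X ?s = ?T"
    unfolding topology_eq
  proof (intro allI iffI)
    fix W assume "openin (uniform_topology X ?s) W"
    then show "openin ?T W"
      unfolding top(1) stop using sf_uniformity_subset[OF u] by (meson subsetD)
  next
    fix W assume W: "openin ?T W"
    then have "\<forall>x\<in>W. \<exists>\<V>\<in>?s. St {x} \<V> \<subseteq> W"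
      using finite_open_cover_at_point[OF u] star_finite_open_covers_subset_sf[OF u] by (meson subsetD)
    moreover have "W \<subseteq> X" using W unfolding top by simp
    ultimately show "openin (uniform_topology X ?s) W" unfolding stop by simp
  qed
qed

lemma covering_structure_sf:
  assumes H: "Hausdorff_uniform_space X \<mu>"
  shows "covering_structure X (sf_uniformity X \<mu>)"
proof -
  have u: "covering_uniformity X \<mu>" using H unfolding Hausdorff_uniform_space_def by blast
  interpret covering_structure X \<mu> by (rule covering_structure_uniformity[OF H])
  show ?thesis
  proof
    show "sf_uniformity X \<mu> \<noteq> {}" by (rule sf_uniformity_nonempty[OF u])
    show "cover_of X \<U>" if "\<U> \<in> sf_uniformity X \<mu>" for \<U>
      using that by (simp add: sf_uniformity_def)
    show "\<U> \<in> sf_uniformity X \<mu>"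
      if "\<V> \<in> sf_uniformity X \<mu>" "cover_of X \<U>" "refines \<V> \<U>" for \<V> \<U>
      using that unfolding sf_uniformity_def by (auto intro: refines_trans)
  qed (simp_all add: uniform_topology_sf[OF u] topspace_eq Hausdorff regular)
qed

section \<open>Star-finite covers by layers\<close>

text \<open>Every family of sets \<open>\<V>\<close> refines a star-finite family. Points are related if they lie in
  a common member of \<open>\<V>\<close>; in each chain component a base point \<open>r\<close> is fixed, and the stars of the sets of
  points at chain distance exactly \<open>n\<close> from \<open>r\<close> form the family. Such a star meets only layers of
  its own component at distances within 1 of \<open>n\<close>, so it meets only stars with index within 2.\<close>

lemma star_finite_coarsening:
  fixes \<V> :: "'a set set"
  shows "\<exists>\<A>. star_finite \<A> \<and> refines \<V> \<A> \<and>
    (\<forall>A\<in>\<A>. (\<exists>\<F>\<subseteq>\<V>. A = \<Union>\<F>) \<and> (\<exists>c n. A \<subseteq> St_iter n {c} \<V>))"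
proof -
  define R where "R = {(x, y). \<exists>V\<in>\<V>. x \<in> V \<and> y \<in> V}"
  have sym: "sym R" unfolding R_def sym_def by blast
  then have symc: "sym (R\<^sup>*)" by (rule sym_rtrancl)
  define r where "r x = (SOME y. (x, y) \<in> R\<^sup>*)" for x
  have rx: "(x, r x) \<in> R\<^sup>*" for x unfolding r_def by (rule someI[of _ x]) simp
  have req: "r x = r y" if "(x, y) \<in> R" for x y
  proof -
    have "(x, z) \<in> R\<^sup>* \<longleftrightarrow> (y, z) \<in> R\<^sup>*" for z
      using that sym by (meson converse_rtrancl_into_rtrancl symD)
    then show ?thesis unfolding r_def by simp
  qed
  define d where "d x = (LEAST n. (r x, x) \<in> R ^^ n)" for x
  have dx: "(r x, x) \<in> R ^^ d x" for x
  proof -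
    have "\<exists>n. (r x, x) \<in> R ^^ n" using rx[of x] symc by (metis rtrancl_imp_relpow symD)
    then show ?thesis unfolding d_def by (rule LeastI_ex)
  qed
  have dle: "d y \<le> Suc (d x)" if "(x, y) \<in> R" for x y
  proof -
    have "(r y, y) \<in> R ^^ Suc (d x)" using dx[of x] that req[OF that] by auto
    then show ?thesis unfolding d_def[of y] by (rule Least_le)
  qed
  have relpow_St: "y \<in> St_iter n {c} \<V>" if "(c, y) \<in> R ^^ n" for c y n
    using that
  proof (induction n arbitrary: y)
    case (Suc n)
    then obtain z where z: "(c, z) \<in> R ^^ n" "(z, y) \<in> R" by auto
    then obtain V where "V \<in> \<V>" "z \<in> V" "y \<in> V" unfolding R_def by blast
    then show ?case using Suc.IH[OF z(1)] by (auto simp: St_def)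
  qed simp
  define B where "B c n = St {x. r x = c \<and> d x = n} \<V>" for c n
  have B: "\<exists>x. r x = c \<and> d x = n \<and> (x, y) \<in> R" if "y \<in> B c n" for y c n
    using that unfolding B_def St_def R_def by blast
  define \<A> where "\<A> = range (\<lambda>(c, n). B c n)"
  have "star_finite \<A>"
    unfolding star_finite_def
  proof
    fix A assume "A \<in> \<A>"
    then obtain c n where A: "A = B c n" unfolding \<A>_def by auto
    have "A' \<in> B c ` {..n + 2}" if A': "A' \<in> \<A>" "A \<inter> A' \<noteq> {}" for A'
    proof -
      obtain c' m where A'_eq: "A' = B c' m" using A' unfolding \<A>_def by auto
      obtain z where z: "z \<in> B c n" "z \<in> B c' m" using A'(2) A A'_eq by blast
      obtain x y where x: "r x = c" "d x = n" "(x, z) \<in> R" and y: "r y = c'" "d y = m" "(y, z) \<in> R"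
        using B[OF z(1)] B[OF z(2)] by blast
      have "(z, y) \<in> R" using y(3) sym by (meson symD)
      then have "m \<le> n + 2" using dle[OF x(3)] dle[of z y] x y by simp
      moreover have "c' = c" using req[OF x(3)] req[OF y(3)] x y by simp
      ultimately show ?thesis using A'_eq by blast
    qed
    then have "{A' \<in> \<A>. A \<inter> A' \<noteq> {}} \<subseteq> B c ` {..n + 2}" by (intro subsetI) (elim CollectE conjE)
    moreover have "finite (B c ` {..n + 2})" by simp
    ultimately show "finite {A' \<in> \<A>. A \<inter> A' \<noteq> {}}" by (rule finite_subset)
  qed
  moreover have "refines \<V> \<A>"
    unfolding refines_def
  proof
    fix V assume v: "V \<in> \<V>"
    \<comment> \<open>The empty set is contained in any member, so the choice of \<open>x\<close> is then irrelevant.\<close>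
    obtain x where x: "x \<in> V \<or> V = {}" by blast
    have "B (r x) (d x) \<in> \<A>" unfolding \<A>_def by auto
    moreover have "V \<subseteq> B (r x) (d x)"
    proof (cases "V = {}")
      case False
      with x have "V \<inter> {y. r y = r x \<and> d y = d x} \<noteq> {}" by auto
      with v show ?thesis unfolding B_def by (rule member_subset_St)
    qed simp
    ultimately show "\<exists>A\<in>\<A>. V \<subseteq> A" by (rule bexI[rotated])
  qed
  moreover have "(\<exists>\<F>\<subseteq>\<V>. A = \<Union>\<F>) \<and> (\<exists>c n. A \<subseteq> St_iter n {c} \<V>)" if A': "A \<in> \<A>" for A
  proof -
    obtain c n where A: "A = B c n" using A' unfolding \<A>_def by auto
    have "\<exists>\<F>\<subseteq>\<V>. A = \<Union>\<F>"
      unfolding A B_def St_def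
      by (rule exI[of _ "{V \<in> \<V>. V \<inter> {x. r x = c \<and> d x = n} \<noteq> {}}"]) simp
    moreover have "y \<in> St_iter (Suc n) {c} \<V>" if y: "y \<in> A" for y
    proof -
      obtain x where "r x = c" "d x = n" "(x, y) \<in> R" using B y A by blast
      then have "(c, y) \<in> R ^^ Suc n" using dx[of x] by auto
      then show ?thesis by (rule relpow_St)
    qed
    ultimately show ?thesis by blast
  qed
  ultimately show ?thesis by blast
qed

text \<open>The coarsening into layers is applied to an open uniform cover with relatively compact stars.
  Each of its members lies in an iterated star of a point, hence in a compact set, and the star of
  a member is a finite union of members.\<close>

lemma star_finite_cover_with_relatively_compact_stars:
  assumes H: "Hausdorff_uniform_space X \<mu>"
    and c: "uniformly_locally_satisfies compact_subset X \<mu>"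
  shows "\<exists>\<A>\<in>star_finite_open_covers X \<mu>.
    \<forall>A\<in>\<A>. \<exists>K. compactin (uniform_topology X \<mu>) K \<and> St A \<A> \<subseteq> K"
proof -
  have u: "covering_uniformity X \<mu>" using H unfolding Hausdorff_uniform_space_def by blast
  interpret covering_structure X \<mu> by (rule covering_structure_uniformity[OF H])
  obtain \<U> where U: "\<U> \<in> \<mu>" "\<And>U. U \<in> \<U> \<Longrightarrow> compactin T U"
    using c unfolding uniformly_locally_satisfies_def compact_subset_def by blast
  obtain \<W> where W: "\<W> \<in> \<mu>" "star_refines \<W> \<U>" by (rule uniform_star_refinement[OF u U(1)])
  define \<V> where "\<V> = (interior_of) T ` \<W>"
  have V: "\<V> \<in> \<mu>" unfolding \<V>_def using uniform_cover_interiors[OF u W(1)] .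
  have opV: "openin T V" if "V \<in> \<V>" for V using that unfolding \<V>_def by auto
  have star: "\<exists>K. compactin T K \<and> St V \<V> \<subseteq> K" if "V \<in> \<V>" for V
  proof -
    obtain W' where W': "W' \<in> \<W>" "V = T interior_of W'" using \<open>V \<in> \<V>\<close> unfolding \<V>_def by blast
    have "St V \<V> \<subseteq> St W' \<W>"
      unfolding St_def \<V>_def W'(2) using interior_of_subset[of T] by fast
    moreover obtain U where "U \<in> \<U>" "St W' \<W> \<subseteq> U" using W(2) W'(1) by (rule star_refinesE)
    ultimately show ?thesis using U(2) by (intro exI[of _ U]) auto
  qed
  from star_finite_coarsening[of \<V>] obtain \<A> where A: "star_finite \<A>" "refines \<V> \<A>"
      "\<forall>A\<in>\<A>. (\<exists>\<F>\<subseteq>\<V>. A = \<Union>\<F>) \<and> (\<exists>c n. A \<subseteq> St_iter n {c} \<V>)"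
    by (elim exE conjE)
  have opA: "openin T A" if "A \<in> \<A>" for A using bspec[OF A(3) that] opV by (auto intro!: openin_Union)
  have subA: "A \<subseteq> X" if "A \<in> \<A>" for A using openin_subset[OF opA[OF that]] topspace_eq by simp
  have "cover_of X \<A>"
    using cover[OF V] A(2) subA by (rule cover_of_if_refined)
  then have "\<A> \<in> \<mu>" using A(2) by (rule upward[OF V])
  then have "\<A> \<in> star_finite_open_covers X \<mu>"
    using A(1) opA unfolding star_finite_open_covers_def by simp
  moreover have "\<exists>K. compactin T K \<and> A \<subseteq> K" if A': "A \<in> \<A>" for A
  proof (cases "A = {}")
    case True
    then show ?thesis using compactin_empty by blast
  next
    case False
    obtain c n where cn: "A \<subseteq> St_iter n {c} \<V>" using bspec[OF A(3) A'] by (elim conjE exE)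
    show ?thesis
    proof (cases "c \<in> X")
      case True
      then have "compactin T {c}" by (simp add: topspace_eq)
      then have "\<exists>K. compactin T K \<and> {c} \<subseteq> K" by (intro exI[of _ "{c}"] conjI subset_refl)
      from St_iter_relatively_compact[OF opV cover[OF V] star this, of n]
      show ?thesis using cn by (meson subset_trans)
    next
      \<comment> \<open>A point outside of the carrier lies in no member of the cover.\<close>
      case False
      have "St_iter n {c} \<V> \<subseteq> {c}"
      proof (induction n)
        case (Suc n)
        then have "St_iter (Suc n) {c} \<V> \<subseteq> St {c} \<V>" by (simp add: St_mono)
        also have "\<dots> = {}" using False cover[OF V] unfolding St_def cover_of_def by blast
        finally show ?case by blast
      qed simp
      then show ?thesis using cn False \<open>A \<noteq> {}\<close> subA[OF A'] by auto
    qed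
  qed
  then obtain k where k: "\<And>A. A \<in> \<A> \<Longrightarrow> compactin T (k A)" "\<And>A. A \<in> \<A> \<Longrightarrow> A \<subseteq> k A" by metis
  have "\<exists>K. compactin T K \<and> St A \<A> \<subseteq> K" if "A \<in> \<A>" for A
  proof -
    let ?N = "{B \<in> \<A>. A \<inter> B \<noteq> {}}"
    have "finite ?N" using A(1) that unfolding star_finite_def by blast
    then have "compactin T (\<Union>(k ` ?N))" using k(1) by (intro compactin_Union) auto
    moreover have "St A \<A> \<subseteq> \<Union>(k ` ?N)"
    proof
      fix x assume "x \<in> St A \<A>"
      then obtain B where B: "B \<in> \<A>" "B \<inter> A \<noteq> {}" "x \<in> B" unfolding St_def by auto
      then show "x \<in> \<Union>(k ` ?N)" using k(2)[OF B(1)] by auto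
    qed
    ultimately show ?thesis by (intro exI conjI)
  qed
  ultimately show ?thesis by (intro bexI ballI)
qed

section \<open>The equivalence\<close>

theorem theorem1p2p19:
  fixes X :: "'a set" and \<mu> :: "'a set set set"
  assumes "Hausdorff_uniform_space X \<mu>"
  shows
    "(uniformly_locally_satisfies compact_subset X \<mu> \<longleftrightarrow>
        locally_satisfies Bourbaki_bounded_subset X \<mu> \<and> cofinally_Bourbaki_complete X \<mu>) \<and>
     (uniformly_locally_satisfies compact_subset X \<mu> \<longleftrightarrow>
        locally_satisfies totally_bounded_subset X \<mu> \<and> cofinally_complete X \<mu>) \<and>
     (uniformly_locally_satisfies compact_subset X \<mu> \<longleftrightarrow>
        uniformly_locally_satisfies compact_subset X (sf_uniformity X \<mu>)) \<and>
     (uniformly_locally_satisfies compact_subset X \<mu> \<longleftrightarrow>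
        locally_satisfies Bourbaki_bounded_subset X (sf_uniformity X \<mu>) \<and>
        cofinally_Bourbaki_complete X (sf_uniformity X \<mu>)) \<and>
     (uniformly_locally_satisfies compact_subset X \<mu> \<longleftrightarrow>
        locally_satisfies totally_bounded_subset X (sf_uniformity X \<mu>) \<and>
        cofinally_complete X (sf_uniformity X \<mu>))"
proof -
  let ?s = "sf_uniformity X \<mu>"
  have u: "covering_uniformity X \<mu>" using assms unfolding Hausdorff_uniform_space_def by blast
  note top = uniform_topology_sf[OF u]
  note sub = sf_uniformity_subset[OF u]
  interpret m: covering_structure X \<mu> by (rule covering_structure_uniformity[OF assms])
  interpret s: covering_structure X ?s by (rule covering_structure_sf[OF assms])
  have from_sf: "uniformly_locally_satisfies compact_subset X \<mu>"
    if "uniformly_locally_satisfies compact_subset X ?s"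
    using that sub top unfolding uniformly_locally_satisfies_def compact_subset_def by auto
  have all: "locally_satisfies totally_bounded_subset X \<mu>"
      "locally_satisfies totally_bounded_subset X ?s"
      "cofinally_Bourbaki_complete X \<mu>" "cofinally_Bourbaki_complete X ?s"
      "uniformly_locally_satisfies compact_subset X ?s"
    if c: "uniformly_locally_satisfies compact_subset X \<mu>"
  proof -
    show tb: "locally_satisfies totally_bounded_subset X \<mu>"
      using locally_totally_bounded_if_uniformly_locally_compact[OF u c] .
    have "totally_bounded_subset X ?s B" if "totally_bounded_subset X \<mu> B" for B
      using that subsetD[OF sub] unfolding totally_bounded_subset_def by simp
    with tb top show "locally_satisfies totally_bounded_subset X ?s"
      by (rule locally_satisfies_mono)
    from star_finite_cover_with_relatively_compact_stars[OF assms c]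
    obtain \<A> where A: "\<A> \<in> star_finite_open_covers X \<mu>"
        "\<forall>A\<in>\<A>. \<exists>K. compactin m.T K \<and> St A \<A> \<subseteq> K" by (elim bexE)
    note star = bspec[OF A(2)]
    have mem: "\<A> \<in> \<mu>" "\<A> \<in> ?s" and op: "\<And>A. A \<in> \<A> \<Longrightarrow> openin m.T A"
      using A(1) star_finite_open_covers_subset_sf[OF u] unfolding star_finite_open_covers_def by auto
    show "cofinally_Bourbaki_complete X \<mu>"
      using mem(1) op star by (rule m.cofinally_Bourbaki_complete_if_relatively_compact_stars)
    show "cofinally_Bourbaki_complete X ?s"
      using mem(2) op[folded top] star[folded top]
      by (rule s.cofinally_Bourbaki_complete_if_relatively_compact_stars)
    show "uniformly_locally_satisfies compact_subset X ?s"
    proof (rule s.uniformly_locally_compact_if_relatively_compact_cover[OF mem(2)])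
      fix A assume A': "A \<in> \<A>"
      have "A \<subseteq> St A \<A>" using A' unfolding St_def by auto
      then show "\<exists>K. compactin s.T K \<and> A \<subseteq> K"
        using star[OF A'] unfolding top by (meson subset_trans)
    qed
  qed
  have bb: "locally_satisfies Bourbaki_bounded_subset X \<nu>"
    if "locally_satisfies totally_bounded_subset X \<nu>" for \<nu>
    using that refl totally_bounded_imp_Bourbaki_bounded by (rule locally_satisfies_mono)
  show ?thesis
    using all from_sf bb m.cofinally_complete_if_Bourbaki s.cofinally_complete_if_Bourbaki
      m.uniformly_locally_compact_if_totally_bounded s.uniformly_locally_compact_if_totally_bounded
      m.uniformly_locally_compact_if_Bourbaki_bounded s.uniformly_locally_compact_if_Bourbaki_bounded
    by blast
qed

end
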